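(* Let $1\le l\le N$ and consider the complex dynamical network with adaptive coupling strength $c(t)$ and with nodes $1,\dots,l$ controlled by event-triggered impulses: \[ \dot{x}_i(t)=f(t,x_i(t)) + c(t)\sum_{j=1}^{N} a_{ij}\,\Gamma x_j(t) + u_i(t),\quad i=1,\dots,l, \] \[ \dot{x}_i(t)=f(t,x_i(t)) + c(t)\sum_{j=1}^{N} a_{ij}\,\Gamma x_j(t),\quad i=l+1,\dots,N, \] with \[ u_i(t)=-\sum_{k\in\mathbb{N}} d_i\,(x_i(t)-z(t))\,\delta(t-t^{(i)}_k),\quad 0<d_i<1,\quad i=1,\dots,l, \] where the impulse times are generated by the event-triggering rule \[ t^{(i)}_{k+1}=\inf\{t>t^{(i)}_k:\ V_i(t)\ge \alpha_i\exp(-\beta_i(t-t_0))\},\quad V_i(t)=\|x_i(t)-z(t)\|^2, \] with constants $\beta_i>0$ and $\alpha_i>V_i(t_0)$ for $i=1,\dots,l$, and where $c(t)$ obeys the adaptive law \[ \dot c(t)=\zeta\sum_{j=l+1}^{N}(x_j(t)-z(t))^\top\Gamma\,(x_j(t)-z(t)),\qquad c(t_0)=c_0, \] with arbitrary constants $c_0\ge 0$ and $\zeta>0$ (all remaining objects are as specified in the context). Suppose that there exists a constant matrix $K\in\mathbb{R}^{n\times n}$ such that $(x-y)^\top (f(t,x)-f(t,y))\le (x-y)^\top K\Gamma (x-y)$ for all $x,y\in\mathbb{R}^n$ and all $t$. Then the network achieves synchronization, that is, \[ \lim_{t\to\infty}\|x_i(t)-z(t)\|=0,\quad i=1,2,\dots,N.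 \]
   Context: Setting. $N$ is the number of nodes and $x_i(t)\in\mathbb{R}^n$ is the state of node $i$; $f:\mathbb{R}^+\times\mathbb{R}^n\to\mathbb{R}^n$ is continuously differentiable; $\Gamma\in\mathbb{R}^{n\times n}$ is positive definite. $A=(a_{ij})\in\mathbb{R}^{N\times N}$ satisfies: for $i\ne j$, $a_{ij}=a_{ji}$, with $a_{ij}>0$ if nodes $i$ and $j$ are connected and $a_{ij}=0$ otherwise; and $a_{ii}=-\sum_{j\ne i}a_{ij}$. $\|\cdot\|$ is the Euclidean norm. Isolated node. $z:[t_0,\infty)\to\mathbb{R}^n$ is a solution of $\dot z(t)=f(t,z(t))$, where $t_0$ is the initial time. Impulses. $\delta$ is the Dirac delta. The impulsive input $u_i$ means the following. States are left-continuous in $t$. At times $t\ne t_k^{(i)}$, node $i$ follows $\dot x_i=f(t,x_i)+c(t)\sum_j a_{ij}\Gamma x_j$. At each impulse time $t=t^{(i)}_k$ ($i\le l$), the synchronization error $e_i=x_i-z$ jumps according to $e_i(t^+)-e_i(t)=-d_ie_i(t)$, i.e. $e_i(t^+)=(1-d_i)e_i(t)$, where $e_i(t^+)$ is the right limit. Different nodes may have different impulse time sequences. Event times. For $i\le l$, the first event time $t^{(i)}_1$ is the first time $t>t_0$ at which $V_i(t)$ reaches the threshold $\alpha_i\exp(-\beta_i(t-t_0))$, and the subsequent ones are given recursively by the displayed rule. If after some event time the threshold is never reached again, node $i$ has only finitely many events (the next event time is $+\infty$).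
   Formalization: Adds the hypothesis that every uncontrolled node is joined by a network path to some controlled node (implied by connectedness); without it the claim is false, e.g. N=2, l=1, A=0, f(t,x)=x, z=0, x_1=0, x_2=e^t. *)

theory Defs
  imports "HOL-Analysis.Analysis"
begin

text \<open>Continuous differentiability on \<open>[0,\<infinity>) \<times> \<real>\<^sup>n\<close>; at the boundary \<open>t = 0\<close> the derivative is
  the (unique) one relative to this set.\<close>

definition cont_diff_on_halfspace :: "(real \<Rightarrow> real ^ 'n \<Rightarrow> real ^ 'n) \<Rightarrow> bool" where
  "cont_diff_on_halfspace f \<longleftrightarrow>
     (\<exists>f' :: real \<times> (real ^ 'n) \<Rightarrow> (real \<times> (real ^ 'n)) \<Rightarrow>\<^sub>L (real ^ 'n).
        continuous_on ({0..} \<times> UNIV) f' \<and>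
        (\<forall>p \<in> {0..} \<times> UNIV.
           ((\<lambda>(t, x). f t x) has_derivative blinfun_apply (f' p)) (at p within {0..} \<times> UNIV)))"

text \<open>Symmetry of the matrix is not required.\<close>

definition positive_definite :: "real ^ 'n ^ 'n \<Rightarrow> bool" where
  "positive_definite M \<longleftrightarrow> (\<forall>x. x \<noteq> 0 \<longrightarrow> x \<bullet> (M *v x) > 0)"

text \<open>The \<open>N \<times> N\<close> matrix is a function whose indices range over \<open>{1..N}\<close>. Two distinct nodes are
  connected by an edge iff the corresponding entry is positive.\<close>

definition coupling_matrix :: "nat \<Rightarrow> (nat \<Rightarrow> nat \<Rightarrow> real) \<Rightarrow> bool" where
  "coupling_matrix N a \<longleftrightarrow>
     (\<forall>i\<in>{1..N}. \<forall>j\<in>{1..N}. i \<noteq> j \<longrightarrow> a i j = a j i \<and> a i j \<ge> 0) \<and>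
     (\<forall>i\<in>{1..N}. a i i = - (\<Sum>j\<in>{1..N} - {i}. a i j))"

definition network_edges :: "nat \<Rightarrow> (nat \<Rightarrow> nat \<Rightarrow> real) \<Rightarrow> (nat \<times> nat) set" where
  "network_edges N a = {(i, j). i \<in> {1..N} \<and> j \<in> {1..N} \<and> i \<noteq> j \<and> a i j > 0}"

text \<open>Event times of the rule ``\<open>V\<close> reaches the threshold \<open>\<theta>\<close>''. Index \<open>0\<close> is the initial time and
  is not itself an event; events are the finite values with index at least \<open>1\<close>. If the threshold is
  never reached again, the infimum is that of the empty set, i.e. \<open>\<infinity>\<close>, and so are all later ones.\<close>

primrec event_time :: "real \<Rightarrow> (real \<Rightarrow> real) \<Rightarrow> (real \<Rightarrow> real) \<Rightarrow> nat \<Rightarrow> ereal" where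
  "event_time t0 V \<theta> 0 = ereal t0"
| "event_time t0 V \<theta> (Suc k) = Inf {ereal t | t. event_time t0 V \<theta> k < ereal t \<and> V t \<ge> \<theta> t}"

definition event_times :: "real \<Rightarrow> (real \<Rightarrow> real) \<Rightarrow> (real \<Rightarrow> real) \<Rightarrow> real set" where
  "event_times t0 V \<theta> = {t. \<exists>k\<ge>1. event_time t0 V \<theta> k = ereal t}"

text \<open>Impulsive solution on \<open>[t0,\<infinity>)\<close> of \<open>x\<^sub>i' = F i t\<close>, where \<open>T i\<close> is the set of impulse times of node
  \<open>i\<close>. A jump of node \<open>j\<close> makes the right-hand side of its neighbours discontinuous, so at such a time
  a neighbour \<open>i\<close> is only continuous, and in general not differentiable. The differential equation
  is therefore imposed off the impulse times of all nodes, and continuity of node \<open>i\<close> off \<open>T i\<close>.\<close>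

definition impulsive_solution ::
  "nat \<Rightarrow> real \<Rightarrow> (nat \<Rightarrow> real set) \<Rightarrow> (nat \<Rightarrow> real) \<Rightarrow> (nat \<Rightarrow> real \<Rightarrow> real ^ 'n) \<Rightarrow>
   (real \<Rightarrow> real ^ 'n) \<Rightarrow> (nat \<Rightarrow> real \<Rightarrow> real ^ 'n) \<Rightarrow> bool" where
  "impulsive_solution N t0 T d F z x \<longleftrightarrow>
     (\<forall>i\<in>{1..N}.
        (\<forall>t\<ge>t0. t \<notin> (\<Union>j\<in>{1..N}. T j) \<longrightarrow>
           (x i has_vector_derivative F i t) (at t within {t0..})) \<and>
        (\<forall>t\<ge>t0. t \<notin> T i \<longrightarrow> continuous (at t within {t0..}) (x i)) \<and>
        (\<forall>t>t0. continuous (at_left t) (x i)) \<and>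
        (\<forall>t\<in>T i. ((\<lambda>s. x i s - z s) \<longlongrightarrow> (1 - d i) *\<^sub>R (x i t - z t)) (at_right t)))"

end

theory Submission
  imports Defs "HOL-Real_Asymp.Real_Asymp"
begin

text \<open>
  Two mechanisms act one after the other: the event trigger takes care of the controlled nodes by itself,
  and the adaptive gain takes care of the remaining ones, for which the controlled nodes are then only an
  exponentially small perturbation. Write \<open>e\<^sub>i = x\<^sub>i - z\<close>.

  \<^emph>\<open>Controlled nodes.\<close> An impulse is fired whenever \<open>V\<^sub>i = \<parallel>e\<^sub>i\<parallel>\<^sup>2\<close> reaches
  \<open>\<alpha>\<^sub>i exp (- \<beta>\<^sub>i (t - t\<^sub>0))\<close>, and it multiplies \<open>V\<^sub>i\<close> by a factor less than one. So \<open>V\<^sub>i\<close> cannot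
  exceed the threshold, provided that the events do not accumulate at a finite time. They do not: at an
  accumulation point, left continuity would make the values before and after the impulses converge to the
  same positive number. This gives \<open>event_trigger.below_threshold\<close>, and also that only finitely many
  impulses occur in bounded time.

  \<^emph>\<open>Coupling.\<close> Since the rows of \<open>a\<close> sum to zero, the coupling acts on the errors, and summation by parts
  turns it into minus a Dirichlet form. Every uncontrolled node is connected to a controlled one, so
  this form dominates the energy of the uncontrolled nodes up to the errors of the controlled ones
  (\<open>pinned_coupling_estimate\<close>). With the one-sided Lipschitz condition on \<open>f\<close>, half the sum of squares
  \<open>W\<close> of the uncontrolled errors satisfies
  \<open>W' \<le> (\<kappa> - \<mu> c) G + c M exp (- b (t - t\<^sub>0))\<close>, where \<open>c' = \<zeta> G\<close> and \<open>G\<close> dominates a multiple of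
  \<open>W\<close>.

  \<^emph>\<open>Adaptive gain.\<close> The gain \<open>c\<close> is nondecreasing. If it is bounded, \<open>G\<close> has a finite integral, which forces
  \<open>W\<close> to converge, and to no limit but zero. If it is unbounded, it eventually overcomes \<open>\<kappa>\<close> and \<open>W\<close>
  is contracted at a rate proportional to \<open>c\<close>, while the perturbation relative to \<open>c\<close> tends to zero. Both
  cases end in \<open>adaptive_gain.decay\<close>.
\<close>

section \<open>Event-triggered quantities stay below their threshold\<close>

lemma event_time_mono: "event_time t0 V \<theta> j \<le> event_time t0 V \<theta> k" if "j \<le> k"
  using that
proof (induction rule: dec_induct)
  case (step n)
  have "event_time t0 V \<theta> n \<le> event_time t0 V \<theta> (Suc n)"
    by (auto intro!: Inf_greatest)
  with step.IH show ?case by (rule order_trans)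
qed simp

text \<open>A nonnegative left-continuous quantity \<open>V\<close> that starts below a positive continuous threshold and is
  multiplied by \<open>q < 1\<close> at each event. It abstracts the squared error of one controlled node, whose
  error vector is scaled by \<open>1 - d\<close>, so that \<open>q = (1 - d)\<^sup>2\<close>. The trigger
  and the reset alone keep \<open>V\<close> below the threshold.\<close>

locale event_trigger =
  fixes t0 :: real and V \<theta> :: "real \<Rightarrow> real" and q :: real
  assumes initial: "V t0 < \<theta> t0"
    and nonneg: "\<And>t. 0 \<le> V t"
    and threshold_pos: "\<And>t. 0 < \<theta> t"
    and threshold_cont: "\<And>t. isCont \<theta> t"
    and left_cont: "\<And>t. t0 < t \<Longrightarrow> (V \<longlongrightarrow> V t) (at_left t)"
    and right_cont_initial: "t0 \<notin> event_times t0 V \<theta> \<Longrightarrow> (V \<longlongrightarrow> V t0) (at_right t0)"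
    and reset_factor: "0 \<le> q" "q < 1"
    and reset: "\<And>t. t \<in> event_times t0 V \<theta> \<Longrightarrow> (V \<longlongrightarrow> q * V t) (at_right t)"
begin

abbreviation "E \<equiv> event_time t0 V \<theta>"

lemma below_before_next_event:
  assumes "E k < ereal t" "ereal t < E (Suc k)"
  shows "V t < \<theta> t"
proof (rule ccontr)
  assume "\<not> V t < \<theta> t"
  then have "E (Suc k) \<le> ereal t"
    using assms(1) by (auto intro!: Inf_lower)
  with assms(2) show False by simp
qed

lemma event_time_ge_initial: "ereal t0 \<le> E k"
  using event_time_mono[of 0 k] by simp

text \<open>A strict inequality between the right limit and the threshold persists on an interval to the
  right, and that interval separates two consecutive event times.\<close>

lemma next_event_later:
  assumes s: "E k = ereal s" and L: "(V \<longlongrightarrow> L) (at_right s)" "L < \<theta> s"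
  obtains r where "s < r" "\<And>t. s < t \<Longrightarrow> t < r \<Longrightarrow> V t < \<theta> t" "ereal r \<le> E (Suc k)"
proof -
  have "(\<theta> \<longlongrightarrow> \<theta> s) (at_right s)"
    using threshold_cont[of s] filterlim_at_split isContD by blast
  then have "((\<lambda>t. V t - \<theta> t) \<longlongrightarrow> L - \<theta> s) (at_right s)"
    using L(1) by (intro tendsto_intros)
  then have "\<forall>\<^sub>F t in at_right s. V t - \<theta> t < 0"
    by (rule order_tendstoD) (use L(2) in simp)
  then obtain r where r: "s < r" "\<And>t. s < t \<Longrightarrow> t < r \<Longrightarrow> V t < \<theta> t"
    unfolding eventually_at_right_field by auto
  have "ereal r \<le> E (Suc k)"
    using s r(2) by (force intro!: Inf_greatest)
  with r that show thesis by blast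
qed

lemma event_time_cases:
  assumes "E k = ereal s"
  shows "s = t0 \<and> s \<notin> event_times t0 V \<theta> \<or> s \<in> event_times t0 V \<theta>"
  using assms by (cases k) (auto simp: event_times_def simp del: event_time.simps(2))

text \<open>Three facts carry each other through the induction. If \<open>V \<le> \<theta>\<close> at an event, the reset
  brings the right limit strictly below \<open>\<theta>\<close>; hence the next event comes strictly later; hence left
  continuity at that next event gives \<open>V \<le> \<theta>\<close> there.\<close>

lemma event_time_real_step:
  assumes "E k = ereal s"
  shows "V s \<le> \<theta> s \<and> E k < E (Suc k) \<and> (\<exists>L<\<theta> s. (V \<longlongrightarrow> L) (at_right s))"
  using assms
proof (induction k arbitrary: s)
  have limit: "E k < E (Suc k) \<and> (\<exists>L<\<theta> s. (V \<longlongrightarrow> L) (at_right s))"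
    if s: "E k = ereal s" and le: "V s \<le> \<theta> s" and init: "s = t0 \<longrightarrow> V s < \<theta> s" for k s
  proof -
    have "\<exists>L<\<theta> s. (V \<longlongrightarrow> L) (at_right s)"
      using event_time_cases[OF s]
    proof
      assume "s = t0 \<and> s \<notin> event_times t0 V \<theta>"
      then show ?thesis using right_cont_initial init by blast
    next
      assume "s \<in> event_times t0 V \<theta>"
      moreover have "q * V s < \<theta> s"
      proof (cases "V s = 0")
        case False
        then have "q * V s < 1 * V s"
          using nonneg[of s] reset_factor by (intro mult_strict_right_mono) auto
        with le show ?thesis by simp
      qed (use threshold_pos in simp)
      ultimately show ?thesis using reset by blast
    qed
    then obtain L where L: "(V \<longlongrightarrow> L) (at_right s)" "L < \<theta> s" by blast
    obtain r where "s < r" "ereal r \<le> E (Suc k)"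
      using next_event_later[OF s L] by blast
    then have "ereal s < E (Suc k)"
      by (meson ereal_less_le less_ereal.simps(1) order_less_le_trans)
    with L s show ?thesis by auto
  qed
  {
    case 0
    then show ?case using limit[of 0 t0] initial by (auto simp del: event_time.simps(2))
  next
    case (Suc k)
    have "E k \<noteq> \<infinity>" "E k \<noteq> -\<infinity>"
      using event_time_mono[of k "Suc k" t0 V \<theta>] Suc.prems event_time_ge_initial[of k]
      by (auto simp del: event_time.simps(2))
    then obtain r where r: "E k = ereal r" by (cases "E k") auto
    have rs: "r < s" using Suc.IH[OF r] r Suc.prems by auto
    have "t0 \<le> r" using event_time_ge_initial[of k] r by simp
    have "V s \<le> \<theta> s"
    proof (rule tendsto_le)
      show "(V \<longlongrightarrow> V s) (at_left s)"
        using left_cont \<open>t0 \<le> r\<close> rs by simp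
      show "(\<theta> \<longlongrightarrow> \<theta> s) (at_left s)"
        using threshold_cont[of s] filterlim_at_split isContD by blast
      show "\<forall>\<^sub>F t in at_left s. V t \<le> \<theta> t"
        unfolding eventually_at_left_field
      proof (intro exI[of _ r] conjI allI impI rs)
        fix t assume "r < t" "t < s"
        then show "V t \<le> \<theta> t"
          using below_before_next_event[of k t] r Suc.prems
          by (simp del: event_time.simps(2))
      qed
    qed simp
    moreover have "s \<noteq> t0" using \<open>t0 \<le> r\<close> rs by simp
    ultimately show ?case using limit[OF Suc.prems] by blast
  }
qed

text \<open>The infimum that defines an event time is attained: just after the event \<open>V\<close> is below the threshold,
  so no points of the set accumulate at the event time from the right.\<close>

lemma threshold_reached_at_event:
  assumes s: "E (Suc k) = ereal s"
  shows "V s = \<theta> s"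
proof -
  obtain L where L: "(V \<longlongrightarrow> L) (at_right s)" "L < \<theta> s" and le: "V s \<le> \<theta> s"
    using event_time_real_step[OF s] by blast
  obtain r where r: "s < r" "\<And>t. s < t \<Longrightarrow> t < r \<Longrightarrow> V t < \<theta> t"
    using next_event_later[OF s L] by blast
  have "E (Suc k) < ereal r" using s r(1) by simp
  then obtain t where t: "E k < ereal t" "\<theta> t \<le> V t" "t < r"
    by (auto simp: Inf_less_iff)
  have "ereal s \<le> ereal t"
    using t s by (auto simp flip: s intro!: Inf_lower)
  with r(2)[of t] t have "t = s" by force
  with t le show ?thesis by simp
qed

text \<open>Left continuity excludes accumulation: at a finite accumulation point \<open>m\<close> of event times, the
  values \<open>V = \<theta>\<close> at the events and the right limits \<open>q * \<theta>\<close> just after them would both tend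
  to the positive number \<open>V m\<close>.\<close>

lemma event_times_unbounded: "\<exists>k. ereal t \<le> E k"
proof (rule ccontr)
  assume "\<nexists>k. ereal t \<le> E k"
  then have less: "E k < ereal t" for k by (simp add: not_le)
  define s where "s k = real_of_ereal (E k)" for k
  have s: "E k = ereal (s k)" for k
    using less[of k] event_time_ge_initial[of k] unfolding s_def by (cases "E k") auto
  have mono: "s k < s (Suc k)" for k
    using event_time_real_step[OF s[of k]] by (simp only: s) auto
  have "strict_mono s" using mono by (simp add: strict_mono_Suc_iff)
  have "incseq s" by (rule strict_mono_mono) fact
  have bound: "s k \<le> t" for k using less[of k] s[of k] by simp
  obtain m where m: "s \<longlonglongrightarrow> m" "\<And>k. s k \<le> m"
    using incseq_convergent[OF \<open>incseq s\<close>] bound by metis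
  have below: "s k < m" for k using mono[of k] m(2)[of "Suc k"] by simp
  have "s 0 = t0" using s[of 0] by simp
  then have "t0 < m" using below[of 0] by simp
  have lim: "(V \<longlongrightarrow> V m) (at_left m)" by (rule left_cont) fact
  have at_left_s: "filterlim s (at_left m) sequentially"
    using m(1) below unfolding filterlim_at by (auto simp: less_imp_neq)
  have "(\<lambda>k. V (s k)) \<longlonglongrightarrow> V m"
    using filterlim_compose[OF lim at_left_s] .
  then have "(\<lambda>k. V (s (Suc k))) \<longlonglongrightarrow> V m" by (rule LIMSEQ_Suc)
  moreover have "V (s (Suc k)) = \<theta> (s (Suc k))" for k
    by (rule threshold_reached_at_event) (rule s)
  moreover have "(\<lambda>k. \<theta> (s (Suc k))) \<longlonglongrightarrow> \<theta> m"
    by (intro isCont_tendsto_compose[OF threshold_cont] LIMSEQ_Suc m)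
  ultimately have "V m = \<theta> m" by (simp add: LIMSEQ_unique)
  then have pos: "V m > 0" using threshold_pos[of m] by simp
  \<comment> \<open>small enough that \<open>q * (1 + h) < 1 - h\<close>: a reset moves any value near \<open>V m\<close> away from it\<close>
  define h where "h = (1 - q) / 4"
  have h: "h > 0" "h < 1" using reset_factor by (auto simp: h_def)
  have "\<forall>\<^sub>F u in at_left m. V m * (1 - h) < V u \<and> V u < V m * (1 + h)"
    using order_tendstoD[OF lim] pos h by (simp add: eventually_conj_iff)
  then obtain r where r: "r < m"
    "\<And>u. r < u \<Longrightarrow> u < m \<Longrightarrow> V m * (1 - h) < V u \<and> V u < V m * (1 + h)"
    unfolding eventually_at_left_field by blast
  obtain k0 where k0: "r < s k0"
    using order_tendstoD(1)[OF m(1) r(1)] by (auto simp: eventually_sequentially)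
  define k where "k = Suc k0"
  have k: "r < s k" using k0 mono[of k0] by (simp add: k_def)
  have "s k \<in> event_times t0 V \<theta>"
    unfolding event_times_def mem_Collect_eq
    by (intro exI[of _ k] conjI s) (simp add: k_def)
  then have "(V \<longlongrightarrow> q * V (s k)) (at_right (s k))" by (rule reset)
  moreover have "\<forall>\<^sub>F u in at_right (s k). V m * (1 - h) \<le> V u"
    unfolding eventually_at_right_field using r(2) k below[of k]
    by (intro exI[of _ m]) (auto intro: less_imp_le)
  ultimately have "V m * (1 - h) \<le> q * V (s k)"
    by (rule tendsto_lowerbound) simp
  also have "\<dots> \<le> q * (V m * (1 + h))"
    using r(2)[OF k below] reset_factor by (intro mult_left_mono) auto
  finally have "V m * (1 - h) \<le> V m * (q * (1 + h))" by (simp add: algebra_simps)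
  then have "1 - h \<le> q * (1 + h)" using pos by simp
  also have "\<dots> \<le> q + h" using reset_factor h mult_right_mono[of q 1 h] by (simp add: algebra_simps)
  finally show False using reset_factor by (simp add: h_def field_simps)
qed

text \<open>As the event times are unbounded, every \<open>t\<close> is an event time or lies strictly between two
  consecutive ones.\<close>

lemma below_threshold:
  assumes "t0 \<le> t"
  shows "V t \<le> \<theta> t"
proof -
  define k where "k = (LEAST k. ereal t \<le> E k)"
  have k: "ereal t \<le> E k"
    unfolding k_def using event_times_unbounded by (metis LeastI_ex)
  show ?thesis
  proof (cases "ereal t = E k")
    case True
    then show ?thesis using event_time_real_step by metis
  next
    case False
    then have "k \<noteq> 0" using assms k by (cases k) auto
    then obtain j where j: "k = Suc j" by (cases k) auto
    then have "E j < ereal t"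
      using not_less_Least[of j "\<lambda>k. ereal t \<le> E k"] by (simp add: k_def)
    moreover have "ereal t < E (Suc j)" using k False j by (simp only: order_less_le) simp
    ultimately show ?thesis
      using below_before_next_event[of j t] by (intro less_imp_le) (simp only:)
  qed
qed

lemma event_times_locally_finite: "finite (event_times t0 V \<theta> \<inter> {..b})"
proof -
  obtain k where k: "ereal (b + 1) \<le> E k" using event_times_unbounded by blast
  have "event_times t0 V \<theta> \<inter> {..b} \<subseteq> (\<lambda>j. real_of_ereal (E j)) ` {..<k}"
  proof
    fix t assume "t \<in> event_times t0 V \<theta> \<inter> {..b}"
    then obtain j where j: "E j = ereal t" "t \<le> b" by (auto simp: event_times_def)
    then have "E j < E k" using k by (metis ereal_less_eq(3) ereal_less(3) order_less_le_trans 
       less_ereal.simps(1) less_add_one order_le_less_trans)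
    then have "j < k" using event_time_mono[of k j t0 V \<theta>] by (meson not_le)
    then show "t \<in> (\<lambda>j. real_of_ereal (E j)) ` {..<k}" using j by force
  qed
  then show ?thesis by (rule finite_subset) simp
qed

end

section \<open>Decay under a nondecreasing adaptive gain\<close>

text \<open>A jump of one node breaks the differentiability of its neighbours at the impulse time, so Lyapunov
  functions are differentiable only off the impulse times; continuity bridges these finitely many
  points.\<close>

lemma nonincreasing_if_deriv_nonpos_off_finite:
  fixes f f' :: "real \<Rightarrow> real"
  assumes "a \<le> b" and "finite S" and cont: "continuous_on {a..b} f"
    and deriv: "\<And>t. t \<in> {a<..<b} - S \<Longrightarrow> (f has_real_derivative f' t) (at t)"
    and nonpos: "\<And>t. t \<in> {a<..<b} - S \<Longrightarrow> f' t \<le> 0"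
  shows "f b \<le> f a"
proof -
  define g where "g t = (if t \<in> {a<..<b} - S then f' t else 0)" for t
  have "(g has_integral (f b - f a)) {a..b}"
    using assms by (intro fundamental_theorem_of_calculus_interior_strong[where S = S])
      (auto simp: g_def has_real_derivative_iff_has_vector_derivative)
  then have "f b - f a \<le> 0"
    by (rule has_integral_le[OF _ has_integral_0]) (use nonpos in \<open>auto simp: g_def\<close>)
  then show ?thesis by simp
qed

lemma bounded_mono_on_tendsto_at_top:
  fixes f :: "real \<Rightarrow> real"
  assumes mono: "mono_on {a..} f" and bound: "\<And>t. a \<le> t \<Longrightarrow> f t \<le> B"
  shows "\<exists>L. (f \<longlongrightarrow> L) at_top"
proof
  have bdd: "bdd_above (f ` {a..})" using bound by (auto intro!: bdd_aboveI)
  show "(f \<longlongrightarrow> (SUP t\<in>{a..}. f t)) at_top"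
  proof (rule increasing_tendsto)
    show "\<forall>\<^sub>F t in at_top. f t \<le> (SUP t\<in>{a..}. f t)"
      using eventually_ge_at_top[of a] by eventually_elim (auto intro!: cSUP_upper bdd)
    fix y assume "y < (SUP t\<in>{a..}. f t)"
    then obtain s where s: "a \<le> s" "y < f s"
      using less_cSUP_iff[OF _ bdd] by auto
    show "\<forall>\<^sub>F t in at_top. y < f t"
      using eventually_ge_at_top[of s]
    proof eventually_elim
      case (elim t)
      then have "f s \<le> f t" using s by (intro mono_onD[OF mono]) auto
      with s show ?case by simp
    qed
  qed
qed

text \<open>In the time scale \<open>\<integral> c\<close>, which reaches infinity because \<open>c \<ge> 1\<close>, the inequality reads
  \<open>dW \<le> r - \<mu> W\<close>, a stable linear equation with vanishing input; so \<open>c\<close> may grow without bound. Once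
  \<open>r\<close> has dropped below \<open>\<mu> \<eta>\<close>, the function \<open>(W - \<eta>) exp (\<mu> \<integral> c)\<close> is nonincreasing.\<close>

lemma decay_under_gain:
  fixes W W' c r :: "real \<Rightarrow> real"
  assumes W_nonneg: "\<And>t. s \<le> t \<Longrightarrow> 0 \<le> W t" and W_cont: "continuous_on {s..} W"
    and fin: "\<And>b. finite (S \<inter> {..b})"
    and W_deriv: "\<And>t. s < t \<Longrightarrow> t \<notin> S \<Longrightarrow> (W has_real_derivative W' t) (at t)"
    and W'_le: "\<And>t. s < t \<Longrightarrow> t \<notin> S \<Longrightarrow> W' t \<le> c t * (r t - \<mu> * W t)"
    and c_cont: "continuous_on {s..} c" and c_ge: "\<And>t. s \<le> t \<Longrightarrow> 1 \<le> c t"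
    and r_lim: "(r \<longlongrightarrow> 0) at_top" and "\<mu> > 0"
  shows "(W \<longlongrightarrow> 0) at_top"
proof (rule order_tendstoI)
  fix y :: real assume "y < 0"
  show "\<forall>\<^sub>F t in at_top. y < W t"
    using eventually_ge_at_top[of s]
  proof eventually_elim
    case (elim t)
    with \<open>y < 0\<close> W_nonneg[of t] show ?case by simp
  qed
next
  fix y :: real assume "0 < y"
  define \<eta> where "\<eta> = y / 2"
  have \<eta>: "0 < \<eta>" "\<eta> < y" using \<open>0 < y\<close> by (auto simp: \<eta>_def)
  have "\<forall>\<^sub>F t in at_top. r t < \<mu> * \<eta>"
    by (rule order_tendstoD[OF r_lim]) (use \<eta> \<open>\<mu> > 0\<close> in simp)
  then obtain t2 where t2: "s \<le> t2" "\<And>t. t2 \<le> t \<Longrightarrow> r t < \<mu> * \<eta>"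
    unfolding eventually_at_top_linorder by (metis max.bounded_iff order_refl)
  have bound: "W b \<le> \<eta> + W t2 * exp (- \<mu> * (b - t2))" if b: "t2 \<le> b" for b
  proof -
    define C where "C t = integral {t2..t} c" for t
    have sub: "{t2..b} \<subseteq> {s..}" using t2(1) by auto
    have c_cont': "continuous_on {t2..b} c" by (rule continuous_on_subset[OF c_cont sub])
    have C_deriv: "(C has_real_derivative c t) (at t within {t2..b})" if "t \<in> {t2..b}" for t
      unfolding C_def by (rule integral_has_real_derivative[OF c_cont' that])
    have C_cont: "continuous_on {t2..b} C"
      unfolding continuous_on_eq_continuous_within
      by (intro ballI DERIV_continuous[OF C_deriv])
    have int_c: "(c has_integral C b) {t2..b}"
      unfolding C_def by (intro integrable_integral integrable_continuous_real c_cont')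
    have int_1: "((\<lambda>_. 1) has_integral (b - t2)) {t2..b}"
      using has_integral_const_real[of "1::real" t2 b] b by simp
    have C_ge: "b - t2 \<le> C b"
      by (rule has_integral_le[OF int_1 int_c]) (use c_ge t2(1) in auto)
    define F where "F t = (W t - \<eta>) * exp (\<mu> * C t)" for t
    have "F b \<le> F t2"
    proof (rule nonincreasing_if_deriv_nonpos_off_finite[OF b fin[of b],
          where f = F and f' = "\<lambda>t. (W' t + \<mu> * c t * (W t - \<eta>)) * exp (\<mu> * C t)"])
      show "continuous_on {t2..b} F"
        unfolding F_def
        by (intro continuous_intros C_cont continuous_on_subset[OF W_cont sub])
    next
      fix t assume t: "t \<in> {t2<..<b} - S \<inter> {..b}"
      then have "t \<notin> S" by auto
      have "(C has_real_derivative c t) (at t)"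
        using C_deriv[of t] t by (simp add: at_within_Icc_at)
      then show "(F has_real_derivative
          (W' t + \<mu> * c t * (W t - \<eta>)) * exp (\<mu> * C t)) (at t)"
        unfolding F_def using t t2(1) \<open>t \<notin> S\<close>
        by (auto intro!: derivative_eq_intros W_deriv simp: algebra_simps)
      have "W' t \<le> c t * (r t - \<mu> * W t)" using t t2(1) \<open>t \<notin> S\<close> by (intro W'_le) auto
      also have "\<dots> \<le> c t * (\<mu> * \<eta> - \<mu> * W t)"
        using t t2 c_ge[of t] by (intro mult_left_mono) (auto intro: less_imp_le)
      finally have "W' t + \<mu> * c t * (W t - \<eta>) \<le> 0" by (simp add: algebra_simps)
      then show "(W' t + \<mu> * c t * (W t - \<eta>)) * exp (\<mu> * C t) \<le> 0"
        by (simp add: mult_nonpos_nonneg)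
    qed
    also have "F t2 \<le> W t2" using \<eta> by (simp add: F_def C_def)
    finally have "W b - \<eta> \<le> W t2 * exp (- \<mu> * C b)"
      by (simp add: F_def exp_minus field_simps)
    also have "\<dots> \<le> W t2 * exp (- \<mu> * (b - t2))"
      using C_ge \<open>\<mu> > 0\<close> W_nonneg[OF t2(1)] by (intro mult_left_mono) auto
    finally show ?thesis by simp
  qed
  have "((\<lambda>b. \<eta> + W t2 * exp (- \<mu> * (b - t2))) \<longlongrightarrow> \<eta>) at_top"
    using \<open>\<mu> > 0\<close> by real_asymp
  then have "\<forall>\<^sub>F b in at_top. \<eta> + W t2 * exp (- \<mu> * (b - t2)) < y"
    by (rule order_tendstoD) fact
  then show "\<forall>\<^sub>F t in at_top. W t < y"
    using eventually_ge_at_top[of t2] by eventually_elim (use bound in force)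
qed

text \<open>The scalar core of the adaptive law: \<open>W\<close> is half the total squared error of the uncontrolled nodes,
  \<open>G\<close> the quadratic form that drives the gain \<open>c\<close>, \<open>\<kappa>\<close> bounds the expansion of the node dynamics,
  \<open>\<mu>\<close> is the contraction supplied by the coupling, and the exponential is what leaks in from the
  controlled nodes.\<close>

locale adaptive_gain =
  fixes W W' G c :: "real \<Rightarrow> real" and S :: "real set"
    and t0 \<kappa> \<mu> M b \<zeta> \<gamma> :: real
  assumes W_nonneg: "\<And>t. t0 \<le> t \<Longrightarrow> 0 \<le> W t" and W_cont: "continuous_on {t0..} W"
    and fin: "\<And>b. finite (S \<inter> {..b})"
    and W_deriv: "\<And>t. t0 < t \<Longrightarrow> t \<notin> S \<Longrightarrow> (W has_real_derivative W' t) (at t)"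
    and W'_le: "\<And>t. t0 < t \<Longrightarrow> t \<notin> S \<Longrightarrow>
      W' t \<le> (\<kappa> - \<mu> * c t) * G t + c t * M * exp (- b * (t - t0))"
    and c_deriv: "\<And>t. t0 \<le> t \<Longrightarrow> (c has_real_derivative \<zeta> * G t) (at t within {t0..})"
    and c_initial: "0 \<le> c t0"
    and G_ge: "\<And>t. t0 \<le> t \<Longrightarrow> \<gamma> * W t \<le> G t"
    and pos: "0 < \<mu>" "0 < b" "0 < \<zeta>" "0 < \<gamma>" "0 \<le> \<kappa>" "0 \<le> M"
begin

lemma G_nonneg: "t0 \<le> t \<Longrightarrow> 0 \<le> G t"
  by (rule order_trans[OF _ G_ge]) (use W_nonneg pos in auto)

lemma c_deriv_at: "(c has_real_derivative \<zeta> * G t) (at t)" if "t0 < t"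
  using c_deriv[of t] that at_within_interior[of t "{t0..}"] by auto

lemma c_cont: "continuous_on {t0..} c"
  unfolding continuous_on_eq_continuous_within
  by (intro ballI DERIV_continuous[OF c_deriv]) simp

lemma c_growth: "c s + h * (t - s) \<le> c t"
  if "t0 \<le> s" "s \<le> t" and h: "\<And>u. s < u \<Longrightarrow> u < t \<Longrightarrow> h \<le> \<zeta> * G u"
proof -
  have "h * t - c t \<le> h * s - c s"
  proof (rule nonincreasing_if_deriv_nonpos_off_finite[where S = "{}"
        and f = "\<lambda>u. h * u - c u" and f' = "\<lambda>u. h - \<zeta> * G u"])
    show "continuous_on {s..t} (\<lambda>u. h * u - c u)"
      by (intro continuous_intros continuous_on_subset[OF c_cont]) (use that in auto)
    show "((\<lambda>u. h * u - c u) has_real_derivative h - \<zeta> * G u) (at u)"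
      if "u \<in> {s<..<t} - {}" for u
      using that \<open>t0 \<le> s\<close> by (auto intro!: derivative_eq_intros c_deriv_at)
  qed (use that in auto)
  then show ?thesis by (simp add: algebra_simps)
qed

lemma c_mono: "mono_on {t0..} c"
proof (rule mono_onI)
  fix s t assume "s \<in> {t0..}" "t \<in> {t0..}" "s \<le> t"
  then show "c s \<le> c t"
    using c_growth[of s t 0] G_nonneg pos by auto
qed

lemma c_nonneg: "t0 \<le> t \<Longrightarrow> 0 \<le> c t"
  using mono_onD[OF c_mono, of t0 t] c_initial by auto

text \<open>If \<open>c\<close> is bounded by \<open>B\<close>, the contraction term may be dropped: \<open>W' - (\<kappa>/\<zeta>) c'\<close> is at most an
  integrable exponential, whose antiderivative completes a nondecreasing function \<open>P\<close> that is bounded above. Since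
  \<open>P\<close> and \<open>c\<close> converge, so does \<open>W\<close>. A positive limit of \<open>W\<close> would make \<open>c\<close> grow linearly.\<close>

lemma decay_if_gain_bounded:
  assumes bound: "\<And>t. t0 \<le> t \<Longrightarrow> c t \<le> B"
  shows "(W \<longlongrightarrow> 0) at_top"
proof -
  obtain cl where c_lim: "(c \<longlongrightarrow> cl) at_top"
    using bounded_mono_on_tendsto_at_top[OF c_mono bound] by blast
  define P where "P t = \<kappa> / \<zeta> * c t - W t - B * M / b * exp (- b * (t - t0))" for t
  have B: "0 \<le> B" using bound[of t0] c_initial by simp
  have "mono_on {t0..} P"
  proof (rule mono_onI)
    fix s t assume st: "s \<in> {t0..}" "t \<in> {t0..}" "s \<le> t"
    have "- P t \<le> - P s"
    proof (rule nonincreasing_if_deriv_nonpos_off_finite[OF st(3) fin[of t],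
          where f = "\<lambda>u. - P u" and
          f' = "\<lambda>u. W' u - \<kappa> * G u - B * M * exp (- b * (u - t0))"])
      show "continuous_on {s..t} (\<lambda>u. - P u)"
        unfolding P_def
        by (intro continuous_intros continuous_on_subset[OF c_cont]
            continuous_on_subset[OF W_cont]) (use st pos in auto)
    next
      fix u assume u: "u \<in> {s<..<t} - S \<inter> {..t}"
      then have u': "t0 < u" "u \<notin> S" using st by auto
      show "((\<lambda>u. - P u) has_real_derivative
          W' u - \<kappa> * G u - B * M * exp (- b * (u - t0))) (at u)"
        unfolding P_def using pos
        by (auto intro!: derivative_eq_intros W_deriv c_deriv_at u' simp: field_simps)
      have "W' u \<le> (\<kappa> - \<mu> * c u) * G u + c u * M * exp (- b * (u - t0))"
        using u' by (rule W'_le)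
      also have "\<dots> \<le> \<kappa> * G u + B * M * exp (- b * (u - t0))"
        using u' pos G_nonneg[of u] c_nonneg[of u] bound[of u]
        by (intro add_mono mult_right_mono) auto
      finally show "W' u - \<kappa> * G u - B * M * exp (- b * (u - t0)) \<le> 0" by simp
    qed
    then show "P s \<le> P t" by simp
  qed
  moreover have "P t \<le> \<kappa> / \<zeta> * B" if "t0 \<le> t" for t
  proof -
    have "\<kappa> / \<zeta> * c t \<le> \<kappa> / \<zeta> * B" using pos bound[OF that] by (intro mult_left_mono) auto
    moreover have "0 \<le> B * M / b * exp (- b * (t - t0))" using B pos by simp
    ultimately show ?thesis using W_nonneg[OF that] by (simp add: P_def)
  qed
  ultimately obtain p where P_lim: "(P \<longlongrightarrow> p) at_top"
    using bounded_mono_on_tendsto_at_top by blast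
  have exp_lim: "((\<lambda>t. exp (- b * (t - t0))) \<longlongrightarrow> 0) at_top"
    using pos by real_asymp
  define w where "w = \<kappa> / \<zeta> * cl - p - B * M / b * 0"
  have "((\<lambda>t. \<kappa> / \<zeta> * c t - P t - B * M / b * exp (- b * (t - t0))) \<longlongrightarrow> w) at_top"
    unfolding w_def by (intro tendsto_diff tendsto_mult_left c_lim P_lim exp_lim)
  then have W_lim: "(W \<longlongrightarrow> w) at_top" by (simp add: P_def)
  have "0 \<le> w"
    by (rule tendsto_lowerbound[OF W_lim])
      (auto intro: eventually_mono[OF eventually_ge_at_top[of t0]] W_nonneg)
  moreover have "\<not> 0 < w"
  proof
    assume "0 < w"
    then have "\<forall>\<^sub>F t in at_top. w / 2 < W t" by (intro order_tendstoD[OF W_lim]) simp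
    then obtain s where s: "t0 \<le> s" "\<And>t. s \<le> t \<Longrightarrow> w / 2 < W t"
      unfolding eventually_at_top_linorder by (metis max.bounded_iff order_refl)
    define h where "h = \<zeta> * (\<gamma> * (w / 2))"
    have h: "0 < h" using \<open>0 < w\<close> pos by (simp add: h_def)
    \<comment> \<open>the time at which linear growth at rate \<open>h\<close> from time \<open>s\<close> exceeds the bound by one\<close>
    define t where "t = s + (B + 1 - c s) / h"
    have "s \<le> t" using bound[OF s(1)] h by (simp add: t_def)
    have "c s + h * (t - s) \<le> c t"
    proof (rule c_growth[OF s(1) \<open>s \<le> t\<close>])
      fix u assume "s < u" "u < t"
      then have "\<gamma> * (w / 2) \<le> \<gamma> * W u" using s(2)[of u] pos by (intro mult_left_mono) auto
      also have "\<dots> \<le> G u" using \<open>s < u\<close> s(1) by (intro G_ge) simp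
      finally show "h \<le> \<zeta> * G u" unfolding h_def using pos by (intro mult_left_mono) auto
    qed
    moreover have "c s + h * (t - s) = B + 1" using h by (simp add: t_def)
    ultimately show False using bound[of t] s(1) \<open>s \<le> t\<close> by simp
  qed
  ultimately have "w = 0" by simp
  with W_lim show ?thesis by simp
qed

text \<open>The gain is monotone, so from some time on \<open>\<mu> c \<ge> 2 \<kappa>\<close>: the coupling absorbs the expansion \<open>\<kappa>\<close>
  and still leaves the contraction \<open>\<mu> c / 2\<close>.\<close>

lemma decay_if_gain_unbounded:
  assumes unbounded: "\<And>B. \<exists>t\<ge>t0. B < c t"
  shows "(W \<longlongrightarrow> 0) at_top"
proof -
  obtain t1 where t1: "t0 \<le> t1" "max 1 (2 * \<kappa> / \<mu>) < c t1"
    using unbounded by blast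
  have c_ge: "1 \<le> c t" "2 * \<kappa> / \<mu> \<le> c t" if "t1 \<le> t" for t
    using mono_onD[OF c_mono, of t1 t] t1 that by auto
  show ?thesis
  proof (rule decay_under_gain[where s = t1 and W' = W' and S = S and c = c
        and r = "\<lambda>t. M * exp (- b * (t - t0))" and \<mu> = "\<mu> / 2 * \<gamma>"])
    fix t assume t: "t1 < t" "t \<notin> S"
    then have "2 * \<kappa> / \<mu> \<le> c t" "1 \<le> c t" "t0 \<le> t" using c_ge[of t] t1 by auto
    then have "\<kappa> - \<mu> * c t \<le> - (\<mu> / 2 * c t)" using pos by (simp add: field_simps)
    then have "(\<kappa> - \<mu> * c t) * G t \<le> - (\<mu> / 2 * c t) * G t"
      using G_nonneg[OF \<open>t0 \<le> t\<close>] by (rule mult_right_mono)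
    moreover have "\<mu> / 2 * c t * (\<gamma> * W t) \<le> \<mu> / 2 * c t * G t"
      using pos \<open>1 \<le> c t\<close> by (intro mult_left_mono G_ge \<open>t0 \<le> t\<close>) auto
    moreover have "W' t \<le> (\<kappa> - \<mu> * c t) * G t + c t * M * exp (- b * (t - t0))"
      using t t1 by (intro W'_le) auto
    ultimately show "W' t \<le> c t * (M * exp (- b * (t - t0)) - \<mu> / 2 * \<gamma> * W t)"
      by (simp add: algebra_simps)
  next
    show "((\<lambda>t. M * exp (- b * (t - t0))) \<longlongrightarrow> 0) at_top" using pos by real_asymp
    show "continuous_on {t1..} W" "continuous_on {t1..} c"
      using t1(1) by (auto intro: continuous_on_subset[OF W_cont] continuous_on_subset[OF c_cont])
  qed (use fin W_nonneg W_deriv c_ge t1 pos in auto)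
qed

lemma decay: "(W \<longlongrightarrow> 0) at_top"
  using decay_if_gain_bounded decay_if_gain_unbounded by (metis not_le)

end

section \<open>The Dirichlet form of a pinned network\<close>

abbreviation quad :: "real ^ 'n ^ 'n \<Rightarrow> real ^ 'n \<Rightarrow> real" where
  "quad M v \<equiv> v \<bullet> (M *v v)"

lemma quad_nonneg: "positive_definite M \<Longrightarrow> 0 \<le> quad M v"
  unfolding positive_definite_def by (cases "v = 0") (auto intro: less_imp_le)

lemma quad_add_le: "quad M (u + v) \<le> 2 * quad M u + 2 * quad M v" if "positive_definite M"
proof -
  have "2 * quad M u + 2 * quad M v - quad M (u + v) = quad M (u - v)"
    by (simp add: algebra_simps inner_simps matrix_vector_right_distrib
        matrix_vector_mult_diff_distrib)
  with quad_nonneg[OF that, of "u - v"] show ?thesis by simp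
qed

lemma quad_coercive:
  fixes M :: "real ^ 'n ^ 'n"
  assumes "positive_definite M"
  obtains \<gamma> where "0 < \<gamma>" "\<And>v. \<gamma> * (norm v)\<^sup>2 \<le> quad M v"
proof -
  have "continuous_on (sphere 0 1) (quad M)"
    by (intro continuous_intros linear_continuous_on) auto
  moreover obtain b :: "real ^ 'n" where "b \<in> Basis" using nonempty_Basis by blast
  then have "sphere (0 :: real ^ 'n) 1 \<noteq> {}" by (auto intro!: exI[of _ b])
  ultimately obtain w where w: "norm w = 1" "\<And>v. norm v = 1 \<Longrightarrow> quad M w \<le> quad M v"
    using continuous_attains_inf[of "sphere 0 1" "quad M"] by auto
  show thesis
  proof
    show "0 < quad M w" using assms w(1) unfolding positive_definite_def by (metis norm_zero zero_neq_one)
    fix v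
    show "quad M w * (norm v)\<^sup>2 \<le> quad M v"
    proof (cases "v = 0")
      case False
      have "quad M w \<le> quad M (v /\<^sub>R norm v)" using False by (intro w) simp
      also have "\<dots> = quad M v / (norm v)\<^sup>2"
        by (simp add: matrix_vector_mult_scaleR power2_eq_square field_simps)
      finally show ?thesis using False by (simp add: field_simps)
    qed simp
  qed
qed

lemma inner_matrix_bound:
  fixes M :: "real ^ 'n ^ 'n"
  obtains B where "0 \<le> B" "\<And>u v. u \<bullet> (M *v v) \<le> B * (norm u * norm v)"
proof -
  obtain B where B: "0 \<le> B" "\<And>v. norm (M *v v) \<le> norm v * B"
    using bounded_linear.nonneg_bounded[OF matrix_vector_mul_bounded_linear, of M] by blast
  have "u \<bullet> (M *v v) \<le> B * (norm u * norm v)" for u v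
  proof -
    have "u \<bullet> (M *v v) \<le> norm u * norm (M *v v)" by (rule norm_cauchy_schwarz)
    also have "\<dots> \<le> norm u * (norm v * B)" by (intro mult_left_mono B) simp
    finally show ?thesis by (simp add: mult_ac)
  qed
  with B(1) that show thesis by blast
qed

lemma quad_dominates:
  fixes M L :: "real ^ 'n ^ 'n"
  assumes "positive_definite M"
  obtains \<kappa> where "0 \<le> \<kappa>" "\<And>v. quad L v \<le> \<kappa> * quad M v"
proof -
  obtain \<gamma> where \<gamma>: "0 < \<gamma>" "\<And>v. \<gamma> * (norm v)\<^sup>2 \<le> quad M v"
    using quad_coercive[OF assms] by blast
  obtain B where B: "0 \<le> B" "\<And>u v. u \<bullet> (L *v v) \<le> B * (norm u * norm v)"
    using inner_matrix_bound by blast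
  have "quad L v \<le> B / \<gamma> * quad M v" for v
  proof -
    have "quad L v \<le> B / \<gamma> * (\<gamma> * (norm v)\<^sup>2)"
      using B(2)[of v v] \<gamma>(1) by (simp add: power2_eq_square)
    also have "\<dots> \<le> B / \<gamma> * quad M v" using B(1) \<gamma> by (intro mult_left_mono) auto
    finally show ?thesis .
  qed
  with that[of "B / \<gamma>"] B(1) \<gamma>(1) show thesis by simp
qed

lemma coupling_row_sum: "(\<Sum>j=1..N. a i j) = 0" if "coupling_matrix N a" "i \<in> {1..N}"
proof -
  have "(\<Sum>j=1..N. a i j) = a i i + (\<Sum>j\<in>{1..N} - {i}. a i j)"
    using that(2) by (simp add: sum.remove)
  with that show ?thesis by (simp add: coupling_matrix_def)
qed

lemma coupling_sym: "coupling_matrix N a \<Longrightarrow> i \<in> {1..N} \<Longrightarrow> j \<in> {1..N} \<Longrightarrow> a i j = a j i"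
  unfolding coupling_matrix_def by (cases "i = j") auto

text \<open>The edge differences \<open>u i - u j\<close> enter through a quadratic form on \<open>\<real>\<^sup>n\<close>, so this is the Dirichlet
  form of the weighted graph with vector-valued potentials.\<close>

definition dirichlet_form ::
  "nat \<Rightarrow> (nat \<Rightarrow> nat \<Rightarrow> real) \<Rightarrow> real ^ 'n ^ 'n \<Rightarrow> (nat \<Rightarrow> real ^ 'n) \<Rightarrow> real" where
  "dirichlet_form N a M u = 1/2 * (\<Sum>i=1..N. \<Sum>j=1..N. a i j * quad M (u i - u j))"

text \<open>Summation by parts: zero row sums allow the diagonal terms \<open>u i \<bullet> M u i\<close> and \<open>u j \<bullet> M u j\<close> to be
  inserted for free. The symmetry of \<open>a\<close> makes the sums of the two mixed terms equal even if
  \<open>M\<close> is not symmetric.\<close>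

lemma coupling_form_eq_dirichlet:
  assumes A: "coupling_matrix N a"
  shows "(\<Sum>i=1..N. \<Sum>j=1..N. a i j * (u i \<bullet> (M *v u j))) = - dirichlet_form N a M u"
proof -
  let ?B = "\<lambda>i j. u i \<bullet> (M *v u j)"
  let ?I = "{1..N}"
  have diag_row: "(\<Sum>i\<in>?I. \<Sum>j\<in>?I. a i j * ?B i i) = 0"
    using coupling_row_sum[OF A] by (simp flip: sum_distrib_right)
  have flip: "(\<Sum>i\<in>?I. \<Sum>j\<in>?I. a i j * g j i) = (\<Sum>i\<in>?I. \<Sum>j\<in>?I. a i j * g i j)" for g
  proof -
    have "(\<Sum>i\<in>?I. \<Sum>j\<in>?I. a i j * g j i) = (\<Sum>j\<in>?I. \<Sum>i\<in>?I. a i j * g j i)"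
      by (rule sum.swap)
    also have "\<dots> = (\<Sum>j\<in>?I. \<Sum>i\<in>?I. a j i * g j i)"
      by (intro sum.cong refl arg_cong2[of _ _ _ _ "(*)"] coupling_sym[OF A])
    finally show ?thesis .
  qed
  have diag_col: "(\<Sum>i\<in>?I. \<Sum>j\<in>?I. a i j * ?B j j) = 0"
    using diag_row flip[of "\<lambda>i j. ?B i i"] by simp
  have "a i j * quad M (u i - u j) =
      a i j * ?B i i + a i j * ?B j j - a i j * ?B i j - a i j * ?B j i" for i j
    by (simp add: algebra_simps inner_simps matrix_vector_mult_diff_distrib)
  then have "2 * dirichlet_form N a M u =
      - (\<Sum>i\<in>?I. \<Sum>j\<in>?I. a i j * ?B i j) - (\<Sum>i\<in>?I. \<Sum>j\<in>?I. a i j * ?B j i)"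
    unfolding dirichlet_form_def
    by (simp only: sum.distrib sum_subtractf diag_row diag_col) simp
  with flip[of ?B] show ?thesis by simp
qed

context
  fixes N :: nat and a :: "nat \<Rightarrow> nat \<Rightarrow> real" and \<Gamma> :: "real ^ 'n ^ 'n"
  assumes A: "coupling_matrix N a" and \<Gamma>: "positive_definite \<Gamma>"
begin

lemma dirichlet_term_nonneg:
  "i \<in> {1..N} \<Longrightarrow> j \<in> {1..N} \<Longrightarrow> 0 \<le> a i j * quad \<Gamma> (u i - u j)"
  using A quad_nonneg[OF \<Gamma>] by (cases "i = j") (auto simp: coupling_matrix_def)

lemma dirichlet_nonneg: "0 \<le> dirichlet_form N a \<Gamma> u"
  unfolding dirichlet_form_def
  by (intro mult_nonneg_nonneg sum_nonneg dirichlet_term_nonneg) auto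

lemma dirichlet_ge_edge:
  assumes i: "i \<in> {1..N}" and j: "j \<in> {1..N}"
  shows "a i j * quad \<Gamma> (u i - u j) \<le> 2 * dirichlet_form N a \<Gamma> u"
proof -
  have "a i j * quad \<Gamma> (u i - u j) \<le> (\<Sum>j=1..N. a i j * quad \<Gamma> (u i - u j))"
    using i j by (intro member_le_sum[of j "{1..N}" "\<lambda>j. a i j * quad \<Gamma> (u i - u j)"]
      dirichlet_term_nonneg) auto
  also have "\<dots> \<le> (\<Sum>i=1..N. \<Sum>j=1..N. a i j * quad \<Gamma> (u i - u j))"
    using i by (intro member_le_sum[of i "{1..N}"
        "\<lambda>i. \<Sum>j=1..N. a i j * quad \<Gamma> (u i - u j)"] sum_nonneg dirichlet_term_nonneg) auto
  finally show ?thesis by (simp add: dirichlet_form_def)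
qed

text \<open>Along a path that starts where \<open>u\<close> vanishes, each edge increases the bound on \<open>quad \<Gamma> (u i)\<close> by a
  controlled amount, because a single edge difference is already bounded by the Dirichlet form. The
  constant depends on the path but not on \<open>u\<close>.\<close>

lemma dirichlet_controls_reachable:
  assumes "(j, i) \<in> (network_edges N a)\<^sup>*" and "j \<in> P"
  shows "\<exists>C\<ge>0. \<forall>u. (\<forall>k\<in>P. u k = 0) \<longrightarrow> quad \<Gamma> (u i) \<le> C * dirichlet_form N a \<Gamma> u"
  using assms(1)
proof (induction rule: rtrancl_induct)
  case base
  show ?case using assms(2) by (auto intro!: exI[of _ 0])
next
  case (step k m)
  then obtain C where C: "0 \<le> C"
    "\<And>u. (\<forall>k\<in>P. u k = 0) \<Longrightarrow> quad \<Gamma> (u k) \<le> C * dirichlet_form N a \<Gamma> u"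
    by blast
  have km: "k \<in> {1..N}" "m \<in> {1..N}" "0 < a m k"
    using step.hyps(2) coupling_sym[OF A] by (auto simp: network_edges_def)
  show ?case
  proof (intro exI[of _ "2 * C + 4 / a m k"] conjI allI impI)
    fix u :: "nat \<Rightarrow> real ^ 'n" assume u: "\<forall>k\<in>P. u k = 0"
    have "quad \<Gamma> (u m) \<le> 2 * quad \<Gamma> (u k) + 2 * quad \<Gamma> (u m - u k)"
      using quad_add_le[OF \<Gamma>, of "u k" "u m - u k"] by simp
    moreover have "quad \<Gamma> (u m - u k) \<le> 2 / a m k * dirichlet_form N a \<Gamma> u"
      using dirichlet_ge_edge[OF km(2,1), of u] km(3) by (simp add: field_simps)
    ultimately show "quad \<Gamma> (u m) \<le> (2 * C + 4 / a m k) * dirichlet_form N a \<Gamma> u"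
      using C(2)[OF u] by (simp add: algebra_simps)
  qed (use C(1) km(3) in simp)
qed

text \<open>A Poincare inequality: pinning the values on \<open>P\<close> removes the kernel of the graph Laplacian as soon as
  every other node is connected to \<open>P\<close>. It replaces the negative definiteness of the principal
  submatrix of the coupling matrix that belongs to the other nodes.\<close>

lemma dirichlet_poincare:
  assumes reach: "\<And>i. i \<in> {1..N} - P \<Longrightarrow> \<exists>j\<in>P. (j, i) \<in> (network_edges N a)\<^sup>*"
  obtains \<mu> where "0 < \<mu>"
    "\<And>u. (\<forall>k\<in>P. u k = 0) \<Longrightarrow> \<mu> * (\<Sum>i=1..N. quad \<Gamma> (u i)) \<le> dirichlet_form N a \<Gamma> u"
proof -
  have "\<exists>C\<ge>0. \<forall>u. (\<forall>k\<in>P. u k = 0) \<longrightarrow> quad \<Gamma> (u i) \<le> C * dirichlet_form N a \<Gamma> u"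
    if "i \<in> {1..N}" for i
  proof (cases "i \<in> P")
    case True
    then show ?thesis by (auto intro!: exI[of _ 0])
  next
    case False
    with that reach[of i] show ?thesis using dirichlet_controls_reachable by blast
  qed
  then obtain C where C: "\<And>i. i \<in> {1..N} \<Longrightarrow> 0 \<le> C i"
    "\<And>i u. i \<in> {1..N} \<Longrightarrow> (\<forall>k\<in>P. u k = 0) \<Longrightarrow> quad \<Gamma> (u i) \<le> C i * dirichlet_form N a \<Gamma> u"
    by metis
  define D where "D = 1 + (\<Sum>i=1..N. C i)"
  have D: "1 \<le> D" unfolding D_def using sum_nonneg[of "{1..N}" C, OF C(1)] by simp
  show thesis
  proof
    show "0 < 1 / D" using D by simp
    fix u :: "nat \<Rightarrow> real ^ 'n" assume u: "\<forall>k\<in>P. u k = 0"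
    have "(\<Sum>i=1..N. quad \<Gamma> (u i)) \<le> (\<Sum>i=1..N. C i * dirichlet_form N a \<Gamma> u)"
      by (intro sum_mono C u)
    also have "\<dots> \<le> D * dirichlet_form N a \<Gamma> u"
      using dirichlet_nonneg[of u] by (simp add: D_def distrib_right flip: sum_distrib_right)
    finally show "1 / D * (\<Sum>i=1..N. quad \<Gamma> (u i)) \<le> dirichlet_form N a \<Gamma> u"
      using D by (simp add: field_simps)
  qed
qed

text \<open>The coupling among the nodes beyond \<open>l\<close> equals minus the Dirichlet form of the vector that is set to
  zero on the first \<open>l\<close> nodes, and so contracts. The influence of the first \<open>l\<close> nodes is a sum of
  products, which Young's inequality splits into half of that contraction and the squares of their
  errors.\<close>

lemma pinned_coupling_estimate:
  assumes l: "1 \<le> l" "l \<le> N"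
    and reach: "\<And>i. i \<in> {l+1..N} \<Longrightarrow> \<exists>j\<in>{1..l}. (j, i) \<in> (network_edges N a)\<^sup>*"
  obtains \<mu> M where "0 < \<mu>" "0 \<le> M"
    "\<And>e. (\<Sum>i=l+1..N. \<Sum>j=1..N. a i j * (e i \<bullet> (\<Gamma> *v e j)))
       \<le> - \<mu> * (\<Sum>i=l+1..N. quad \<Gamma> (e i)) + M * (\<Sum>j=1..l. (norm (e j))\<^sup>2)"
proof -
  have split: "{1..N} = {1..l} \<union> {l+1..N}" "{1..l} \<inter> {l+1..N} = {}" using l by auto
  have reach': "\<exists>j\<in>{1..l}. (j, i) \<in> (network_edges N a)\<^sup>*" if "i \<in> {1..N} - {1..l}" for i
    using that by (intro reach) auto
  obtain \<mu> where \<mu>: "0 < \<mu>" "\<And>u. (\<forall>k\<in>{1..l}. u k = 0) \<Longrightarrow>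
      \<mu> * (\<Sum>i=1..N. quad \<Gamma> (u i)) \<le> dirichlet_form N a \<Gamma> u"
    by (rule dirichlet_poincare[of "{1..l}", OF reach']) blast+
  obtain \<gamma> where \<gamma>: "0 < \<gamma>" "\<And>v. \<gamma> * (norm v)\<^sup>2 \<le> quad \<Gamma> v"
    using quad_coercive[OF \<Gamma>] by blast
  obtain B where B: "0 \<le> B" "\<And>u v. u \<bullet> (\<Gamma> *v v) \<le> B * (norm u * norm v)"
    using inner_matrix_bound by blast
  define R where "R = B * (\<Sum>i=1..N. \<Sum>j=1..N. \<bar>a i j\<bar>)"
  \<comment> \<open>each node pays \<open>\<nu>\<close> once for each of the \<open>l\<close> pinned nodes: \<open>l \<nu> = \<mu> \<gamma> / 2\<close> costs half of the contraction\<close>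
  define \<nu> where "\<nu> = \<mu> * \<gamma> / (2 * real l)"
  have \<nu>: "0 < \<nu>" using \<mu>(1) \<gamma>(1) l by (simp add: \<nu>_def)
  define M where "M = real N * (R\<^sup>2 / (4 * \<nu>))"
  have young: "a i j * (e i \<bullet> (\<Gamma> *v e j)) \<le> \<nu> * (norm (e i))\<^sup>2 + R\<^sup>2 / (4 * \<nu>) * (norm (e j))\<^sup>2"
    if ij: "i \<in> {l+1..N}" "j \<in> {1..l}" for i j and e :: "nat \<Rightarrow> real ^ 'n"
  proof -
    have mem: "i \<in> {1..N}" "j \<in> {1..N}" "i \<noteq> j" using ij l by auto
    then have a: "0 \<le> a i j" using A by (simp add: coupling_matrix_def)
    have "a i j \<le> (\<Sum>j=1..N. \<bar>a i j\<bar>)"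
      using member_le_sum[of j "{1..N}" "\<lambda>j. \<bar>a i j\<bar>"] mem by auto
    also have "\<dots> \<le> (\<Sum>i=1..N. \<Sum>j=1..N. \<bar>a i j\<bar>)"
      using mem
      by (intro member_le_sum[of i "{1..N}" "\<lambda>i. \<Sum>j=1..N. \<bar>a i j\<bar>"] sum_nonneg) auto
    finally have aR: "a i j * B \<le> R" unfolding R_def using B(1) by (simp add: mult.commute mult_left_mono)
    have "a i j * (e i \<bullet> (\<Gamma> *v e j)) \<le> a i j * (B * (norm (e i) * norm (e j)))"
      by (intro mult_left_mono B a)
    also have "\<dots> = a i j * B * (norm (e i) * norm (e j))" by simp
    also have "\<dots> \<le> R * (norm (e i) * norm (e j))"
      by (intro mult_right_mono aR) simp
    also have "\<dots> \<le> \<nu> * (norm (e i))\<^sup>2 + R\<^sup>2 / (4 * \<nu>) * (norm (e j))\<^sup>2"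
    proof -
      have "0 \<le> (2 * \<nu> * norm (e i) - R * norm (e j))\<^sup>2" by simp
      then show ?thesis using \<nu> by (simp add: field_simps power2_eq_square)
    qed
    finally show ?thesis .
  qed
  have "(\<Sum>i=l+1..N. \<Sum>j=1..N. a i j * (e i \<bullet> (\<Gamma> *v e j)))
       \<le> - (\<mu> / 2) * (\<Sum>i=l+1..N. quad \<Gamma> (e i)) + M * (\<Sum>j=1..l. (norm (e j))\<^sup>2)"
    for e :: "nat \<Rightarrow> real ^ 'n"
  proof -
    let ?G = "\<Sum>i=l+1..N. quad \<Gamma> (e i)"
    let ?t = "\<lambda>i j. a i j * (e i \<bullet> (\<Gamma> *v e j))"
    define u where "u i = (if i \<in> {1..l} then 0 else e i)" for i
    have "(\<Sum>i=l+1..N. \<Sum>j=l+1..N. ?t i j)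
        = (\<Sum>i=1..N. \<Sum>j=1..N. a i j * (u i \<bullet> (\<Gamma> *v u j)))"
      unfolding split(1) by (simp add: sum.union_disjoint u_def)
    also have "\<dots> = - dirichlet_form N a \<Gamma> u" by (rule coupling_form_eq_dirichlet[OF A])
    also have "\<dots> \<le> - (\<mu> * (\<Sum>i=1..N. quad \<Gamma> (u i)))"
      using \<mu>(2)[of u] by (simp add: u_def)
    also have "(\<Sum>i=1..N. quad \<Gamma> (u i)) = ?G"
      unfolding split(1) by (simp add: sum.union_disjoint u_def)
    finally have inner: "(\<Sum>i=l+1..N. \<Sum>j=l+1..N. ?t i j) \<le> - (\<mu> * ?G)" .
    have "(\<Sum>i=l+1..N. \<Sum>j=1..l. ?t i j) \<le>
        (\<Sum>i=l+1..N. \<Sum>j=1..l. \<nu> * (norm (e i))\<^sup>2 + R\<^sup>2 / (4 * \<nu>) * (norm (e j))\<^sup>2)"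
      by (intro sum_mono young)
    also have "\<dots> = real l * \<nu> * (\<Sum>i=l+1..N. (norm (e i))\<^sup>2)
        + real (N - l) * (R\<^sup>2 / (4 * \<nu>)) * (\<Sum>j=1..l. (norm (e j))\<^sup>2)"
      by (simp add: sum.distrib sum_distrib_left sum_divide_distrib mult_ac)
    also have "\<dots> \<le> \<mu> / 2 * ?G + M * (\<Sum>j=1..l. (norm (e j))\<^sup>2)"
    proof (rule add_mono)
      have "real l * \<nu> * (\<Sum>i=l+1..N. (norm (e i))\<^sup>2) = \<mu> / 2 * (\<Sum>i=l+1..N. \<gamma> * (norm (e i))\<^sup>2)"
        using l by (simp add: \<nu>_def flip: sum_distrib_left)
      also have "\<dots> \<le> \<mu> / 2 * ?G" using \<mu>(1) by (intro mult_left_mono sum_mono \<gamma>) auto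
      finally show "real l * \<nu> * (\<Sum>i=l+1..N. (norm (e i))\<^sup>2) \<le> \<mu> / 2 * ?G" .
      show "real (N - l) * (R\<^sup>2 / (4 * \<nu>)) * (\<Sum>j=1..l. (norm (e j))\<^sup>2)
          \<le> M * (\<Sum>j=1..l. (norm (e j))\<^sup>2)"
        unfolding M_def using \<nu> by (intro mult_right_mono sum_nonneg) auto
    qed
    finally have cross: "(\<Sum>i=l+1..N. \<Sum>j=1..l. ?t i j)
        \<le> \<mu> / 2 * ?G + M * (\<Sum>j=1..l. (norm (e j))\<^sup>2)" .
    have "(\<Sum>i=l+1..N. \<Sum>j=1..N. ?t i j)
        = (\<Sum>i=l+1..N. \<Sum>j=1..l. ?t i j) + (\<Sum>i=l+1..N. \<Sum>j=l+1..N. ?t i j)"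
      unfolding split(1) sum.distrib[symmetric]
      by (intro sum.cong refl sum.union_disjoint split(2)) auto
    with inner cross show ?thesis by (simp add: algebra_simps)
  qed
  moreover have "0 \<le> M" using \<nu> by (simp add: M_def)
  ultimately show thesis using that[of "\<mu> / 2" M] \<mu>(1) by simp
qed

end

section \<open>Synchronization\<close>

lemma tendsto_norm_zero_if_square_bound:
  assumes "(g \<longlongrightarrow> 0) F" and "\<forall>\<^sub>F t in F. (norm (v t))\<^sup>2 \<le> g t"
  shows "((\<lambda>t. norm (v t)) \<longlongrightarrow> 0) F"
proof -
  have "((\<lambda>t. (norm (v t))\<^sup>2) \<longlongrightarrow> 0) F"
    by (rule tendsto_sandwich[OF _ assms(2) tendsto_const assms(1)]) simp
  then have "((\<lambda>t. sqrt ((norm (v t))\<^sup>2)) \<longlongrightarrow> sqrt 0) F" by (rule tendsto_real_sqrt)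
  then show ?thesis by simp
qed

lemma has_real_derivative_half_sum_norm_squares:
  fixes e :: "'i \<Rightarrow> real \<Rightarrow> 'a :: real_inner"
  assumes "\<And>i. i \<in> I \<Longrightarrow> (e i has_vector_derivative e' i) (at t)"
  shows "((\<lambda>t. (\<Sum>i\<in>I. (norm (e i t))\<^sup>2) / 2) has_real_derivative (\<Sum>i\<in>I. e i t \<bullet> e' i)) (at t)"
proof -
  have "((\<lambda>t. (norm (e i t))\<^sup>2 / 2) has_real_derivative (e i t \<bullet> e' i)) (at t)"
    if "i \<in> I" for i
  proof -
    have "((\<lambda>t. e i t \<bullet> e i t) has_vector_derivative (e i t \<bullet> e' i + e' i \<bullet> e i t)) (at t)"
      using bounded_bilinear.has_vector_derivative[OF bounded_bilinear_inner assms[OF that] assms[OF that]] .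
    then have "((\<lambda>t. (e i t \<bullet> e i t) / 2) has_real_derivative (e i t \<bullet> e' i + e' i \<bullet> e i t) / 2) (at t)"
      unfolding has_real_derivative_iff_has_vector_derivative[symmetric] by (rule DERIV_cdivide)
    then show ?thesis by (simp add: power2_norm_eq_inner inner_commute)
  qed
  then show ?thesis
    unfolding sum_divide_distrib by (rule DERIV_sum)
qed

text \<open>The coupling is diffusive: by the zero row sums it sees only the deviations from a common state.\<close>

lemma synchronization_error_coupling:
  fixes M :: "real ^ 'n ^ 'n"
  assumes "coupling_matrix N a" and "i \<in> {1..N}"
  shows "(\<Sum>j=1..N. a i j *\<^sub>R (M *v x j)) = (\<Sum>j=1..N. a i j *\<^sub>R (M *v (x j - z)))"
proof -
  have "(\<Sum>j=1..N. a i j *\<^sub>R (M *v (x j - z)))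
      = (\<Sum>j=1..N. a i j *\<^sub>R (M *v x j)) - (\<Sum>j=1..N. a i j) *\<^sub>R (M *v z)"
    by (simp add: matrix_vector_mult_diff_distrib scaleR_diff_right sum_subtractf scaleR_sum_left)
  with coupling_row_sum[OF assms] show ?thesis by simp
qed

theorem theorem2:
  fixes f :: "real \<Rightarrow> real ^ 'n \<Rightarrow> real ^ 'n"
    and \<Gamma> K :: "real ^ 'n ^ 'n"
    and N l :: nat
    and a :: "nat \<Rightarrow> nat \<Rightarrow> real"
    and x :: "nat \<Rightarrow> real \<Rightarrow> real ^ 'n"
    and z :: "real \<Rightarrow> real ^ 'n"
    and c :: "real \<Rightarrow> real"
    and d \<alpha> \<beta> :: "nat \<Rightarrow> real"
    and t0 c0 \<zeta> :: real
    and T :: "nat \<Rightarrow> real set"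
  assumes "1 \<le> l" and "l \<le> N" and "0 \<le> t0"
    and "cont_diff_on_halfspace f"
    and "positive_definite \<Gamma>"
    and "coupling_matrix N a"
    and reachable: "\<And>i. i \<in> {l+1..N} \<Longrightarrow> \<exists>j\<in>{1..l}. (j, i) \<in> (network_edges N a)\<^sup>*"
    and "\<And>t. t \<ge> t0 \<Longrightarrow> (z has_vector_derivative f t (z t)) (at t within {t0..})"
    and "\<And>i. i \<in> {1..l} \<Longrightarrow> 0 < d i \<and> d i < 1"
    and "\<And>i. i \<in> {1..l} \<Longrightarrow> \<beta> i > 0"
    and "\<And>i. i \<in> {1..l} \<Longrightarrow> \<alpha> i > (norm (x i t0 - z t0))\<^sup>2"
    and "\<And>i. i \<in> {1..l} \<Longrightarrow>
           T i = event_times t0 (\<lambda>t. (norm (x i t - z t))\<^sup>2) (\<lambda>t. \<alpha> i * exp (- \<beta> i * (t - t0)))"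
    and "\<And>i. i \<in> {l+1..N} \<Longrightarrow> T i = {}"
    and "impulsive_solution N t0 T d
           (\<lambda>i t. f t (x i t) + c t *\<^sub>R (\<Sum>j=1..N. a i j *\<^sub>R (\<Gamma> *v x j t))) z x"
    and "c0 \<ge> 0" and "\<zeta> > 0" and "c t0 = c0"
    and "\<And>t. t \<ge> t0 \<Longrightarrow>
           (c has_real_derivative
              \<zeta> * (\<Sum>j=l+1..N. (x j t - z t) \<bullet> (\<Gamma> *v (x j t - z t)))) (at t within {t0..})"
    and "\<And>t u v. t \<ge> 0 \<Longrightarrow> (u - v) \<bullet> (f t u - f t v) \<le> (u - v) \<bullet> ((K ** \<Gamma>) *v (u - v))"
  shows "\<forall>i\<in>{1..N}. ((\<lambda>t. norm (x i t - z t)) \<longlongrightarrow> 0) at_top"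
proof -
  note l = assms(1,2) and \<Gamma> = assms(5) and A = assms(6) and z_deriv = assms(8)
    and d = assms(9) and \<beta> = assms(10) and \<alpha> = assms(11) and T_event = assms(12)
    and T_empty = assms(13) and sol = assms(14)[unfolded impulsive_solution_def, rule_format]
    and c_deriv = assms(18) and f_bound = assms(19)
  define e where "e i t = x i t - z t" for i t
  define F where "F i t = f t (x i t) + c t *\<^sub>R (\<Sum>j=1..N. a i j *\<^sub>R (\<Gamma> *v x j t))" for i t
  define \<theta> where "\<theta> i t = \<alpha> i * exp (- \<beta> i * (t - t0))" for i t
  define V where "V i t = (norm (e i t))\<^sup>2" for i t
  define S where "S = (\<Union>i\<in>{1..N}. T i)"

  have T_V: "T i = event_times t0 (V i) (\<theta> i)" if "i \<in> {1..l}" for i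
    using T_event[OF that] by (simp add: V_def[abs_def] e_def \<theta>_def[abs_def])
  have z_cont: "continuous (at t within {t0..}) z" if "t0 \<le> t" for t
    using z_deriv[OF that] by (rule has_vector_derivative_continuous)

  have trigger: "event_trigger t0 (V i) (\<theta> i) ((1 - d i)\<^sup>2)" if i: "i \<in> {1..l}" for i
  proof
    have iN: "i \<in> {1..N}" using i l by auto
    show "V i t0 < \<theta> i t0" using \<alpha>[OF i] by (simp add: V_def e_def \<theta>_def)
    show "0 \<le> V i t" for t by (simp add: V_def)
    have "0 < \<alpha> i" using \<alpha>[OF i] by (rule le_less_trans[rotated]) simp
    then show "0 < \<theta> i t" for t by (simp add: \<theta>_def)
    show "isCont (\<theta> i) t" for t unfolding \<theta>_def[abs_def] by (intro continuous_intros)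
    show "(V i \<longlongrightarrow> V i t) (at_left t)" if "t0 < t" for t
    proof -
      have "isCont z t"
        using z_cont[of t] that at_within_interior[of t "{t0..}"] by auto
      then have "(z \<longlongrightarrow> z t) (at_left t)" using filterlim_at_split isContD by blast
      moreover have "(x i \<longlongrightarrow> x i t) (at_left t)"
        using sol[OF iN] that by (auto simp: continuous_within)
      ultimately show ?thesis unfolding V_def[abs_def] e_def[abs_def] by (intro tendsto_intros)
    qed
    show "(V i \<longlongrightarrow> V i t0) (at_right t0)" if "t0 \<notin> event_times t0 (V i) (\<theta> i)"
    proof -
      have sub: "at_right t0 \<le> at t0 within {t0..}" by (rule at_le) auto
      have "(x i \<longlongrightarrow> x i t0) (at t0 within {t0..})"
        using sol[OF iN] that T_V[OF i] by (auto simp: continuous_within)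
      moreover have "(z \<longlongrightarrow> z t0) (at t0 within {t0..})"
        using z_cont[of t0] by (simp add: continuous_within)
      ultimately have "(V i \<longlongrightarrow> V i t0) (at t0 within {t0..})"
        unfolding V_def[abs_def] e_def[abs_def] by (intro tendsto_intros)
      then show ?thesis using sub by (rule tendsto_mono[rotated])
    qed
    show "0 \<le> (1 - d i)\<^sup>2" by simp
    show "(1 - d i)\<^sup>2 < 1" using d[OF i] by (simp add: power_less_one_iff abs_square_less_1)
    show "(V i \<longlongrightarrow> (1 - d i)\<^sup>2 * V i t) (at_right t)" if "t \<in> event_times t0 (V i) (\<theta> i)" for t
    proof -
      have "((\<lambda>s. x i s - z s) \<longlongrightarrow> (1 - d i) *\<^sub>R (x i t - z t)) (at_right t)"
        using sol[OF iN] that T_V[OF i] by auto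
      then have "(V i \<longlongrightarrow> (norm ((1 - d i) *\<^sub>R (x i t - z t)))\<^sup>2) (at_right t)"
        unfolding V_def[abs_def] e_def[abs_def] by (intro tendsto_intros)
      then show ?thesis by (simp add: V_def e_def power_mult_distrib)
    qed
  qed

  have leader_bound: "V i t \<le> \<theta> i t" if "i \<in> {1..l}" "t0 \<le> t" for i t
    using event_trigger.below_threshold[OF trigger] that by blast
  have S_fin: "finite (S \<inter> {..s})" for s
  proof -
    have "finite (T i \<inter> {..s})" if "i \<in> {1..N}" for i
    proof (cases "i \<le> l")
      case True
      then have i: "i \<in> {1..l}" using that by simp
      show ?thesis
        unfolding T_V[OF i] by (rule event_trigger.event_times_locally_finite[OF trigger[OF i]])
    qed (use T_empty[of i] that in auto)
    moreover have "S \<inter> {..s} = (\<Union>i\<in>{1..N}. T i \<inter> {..s})" by (auto simp: S_def)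
    ultimately show ?thesis by (simp only: finite_UN_I finite_atLeastAtMost)
  qed

  have e_deriv: "(e i has_vector_derivative F i t - f t (z t)) (at t)"
    if i: "i \<in> {1..N}" and t: "t0 < t" "t \<notin> S" for i t
  proof -
    have "(x i has_vector_derivative F i t) (at t within {t0..})"
      using sol[OF i] t unfolding F_def S_def by (meson less_imp_le)
    then have "(e i has_vector_derivative F i t - f t (z t)) (at t within {t0..})"
      unfolding e_def[abs_def] using z_deriv[of t] t by (intro has_vector_derivative_diff) auto
    moreover have "at t within {t0..} = at t" using t by (intro at_within_interior) auto
    ultimately show ?thesis by simp
  qed

  \<comment> \<open>the slowest of the threshold rates gives one exponential bound for all controlled nodes\<close>
  define b where "b = Min (\<beta> ` {1..l})"
  have b: "0 < b" "\<And>i. i \<in> {1..l} \<Longrightarrow> b \<le> \<beta> i"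
    unfolding b_def using l \<beta> by (auto simp: Min_gr_iff)
  have \<alpha>_nonneg: "0 \<le> \<alpha> i" if "i \<in> {1..l}" for i
    using \<alpha>[OF that] by (rule order_trans[OF _ less_imp_le, rotated]) simp
  have leaders: "(\<Sum>j=1..l. (norm (e j t))\<^sup>2) \<le> (\<Sum>j=1..l. \<alpha> j) * exp (- b * (t - t0))"
    if "t0 \<le> t" for t
    unfolding sum_distrib_right
  proof (rule sum_mono)
    fix j assume j: "j \<in> {1..l}"
    have "(norm (e j t))\<^sup>2 \<le> \<alpha> j * exp (- \<beta> j * (t - t0))"
      using leader_bound[OF j that] by (simp add: V_def \<theta>_def)
    also have "\<dots> \<le> \<alpha> j * exp (- b * (t - t0))"
      using b(2)[OF j] that \<alpha>_nonneg[OF j] by (intro mult_left_mono) (auto intro: mult_right_mono)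
    finally show "(norm (e j t))\<^sup>2 \<le> \<alpha> j * exp (- b * (t - t0))" .
  qed

  obtain \<mu> M where \<mu>: "0 < \<mu>" and M: "0 \<le> M" and coupling:
    "\<And>v. (\<Sum>i=l+1..N. \<Sum>j=1..N. a i j * (v i \<bullet> (\<Gamma> *v v j)))
       \<le> - \<mu> * (\<Sum>i=l+1..N. quad \<Gamma> (v i)) + M * (\<Sum>j=1..l. (norm (v j))\<^sup>2)"
    using pinned_coupling_estimate[OF A \<Gamma> l reachable] by blast
  obtain \<gamma> where \<gamma>: "0 < \<gamma>" "\<And>v. \<gamma> * (norm v)\<^sup>2 \<le> quad \<Gamma> v"
    using quad_coercive[OF \<Gamma>] by blast
  obtain \<kappa> where \<kappa>: "0 \<le> \<kappa>" "\<And>v. quad (K ** \<Gamma>) v \<le> \<kappa> * quad \<Gamma> v"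
    using quad_dominates[OF \<Gamma>] by blast

  define W where "W t = (\<Sum>i=l+1..N. (norm (e i t))\<^sup>2) / 2" for t
  define W' where "W' t = (\<Sum>i=l+1..N. e i t \<bullet> (F i t - f t (z t)))" for t
  define G where "G t = (\<Sum>i=l+1..N. quad \<Gamma> (e i t))" for t
  have gain: "(c has_real_derivative \<zeta> * G t) (at t within {t0..})" if "t0 \<le> t" for t
    using c_deriv[OF that] by (simp add: G_def e_def)
  have c_nonneg: "0 \<le> c t" if "t0 \<le> t" for t
  proof -
    have "c t0 \<le> c t"
    proof (rule DERIV_nonneg_imp_increasing_open[OF that])
      have "continuous_on {t0..} c"
        unfolding continuous_on_eq_continuous_within
        by (intro ballI DERIV_continuous[OF gain]) simp
      then show "continuous_on {t0..t} c" by (rule continuous_on_subset) auto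
      fix s assume "t0 < s" "s < t"
      then have "(c has_real_derivative \<zeta> * G s) (at s)"
        using gain[of s] at_within_interior[of s "{t0..}"] by auto
      moreover have "0 \<le> \<zeta> * G s"
        using assms(16) quad_nonneg[OF \<Gamma>] by (simp add: G_def sum_nonneg)
      ultimately show "\<exists>y. (c has_real_derivative y) (at s) \<and> 0 \<le> y" by blast
    qed
    then show ?thesis using assms(15,17) by simp
  qed

  have "(W \<longlongrightarrow> 0) at_top"
  proof (rule adaptive_gain.decay, unfold_locales)
    show "0 \<le> W t" for t by (simp add: W_def sum_nonneg)
    show "continuous_on {t0..} W"
    proof -
      have "continuous_on {t0..} (e i)" if "i \<in> {l+1..N}" for i
        unfolding continuous_on_eq_continuous_within e_def[abs_def]
        using sol[of i] that T_empty[OF that] by (auto intro!: continuous_diff z_cont)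
      then show ?thesis unfolding W_def[abs_def] by (intro continuous_intros) auto
    qed
    show "finite (S \<inter> {..s})" for s by (rule S_fin)
    show "(W has_real_derivative W' t) (at t)" if "t0 < t" "t \<notin> S" for t
      unfolding W_def[abs_def] W'_def
      by (intro has_real_derivative_half_sum_norm_squares e_deriv that) auto
    show "W' t \<le> (\<kappa> - \<mu> * c t) * G t + c t * (M * (\<Sum>j=1..l. \<alpha> j)) * exp (- b * (t - t0))"
      if t: "t0 < t" "t \<notin> S" for t
    proof -
      have node_bound: "e i t \<bullet> (F i t - f t (z t)) \<le>
          \<kappa> * quad \<Gamma> (e i t) + c t * (\<Sum>j=1..N. a i j * (e i t \<bullet> (\<Gamma> *v e j t)))"
        if i: "i \<in> {l+1..N}" for i
      proof -
        have iN: "i \<in> {1..N}" using i by auto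
        have "F i t - f t (z t)
            = (f t (x i t) - f t (z t)) + c t *\<^sub>R (\<Sum>j=1..N. a i j *\<^sub>R (\<Gamma> *v e j t))"
          unfolding F_def e_def synchronization_error_coupling[OF A iN, of \<Gamma> "\<lambda>j. x j t" "z t"]
          by simp
        then have "e i t \<bullet> (F i t - f t (z t)) = e i t \<bullet> (f t (x i t) - f t (z t))
            + c t * (\<Sum>j=1..N. a i j * (e i t \<bullet> (\<Gamma> *v e j t)))"
          by (simp only: inner_add_right inner_scaleR_right inner_sum_right)
        moreover have "e i t \<bullet> (f t (x i t) - f t (z t)) \<le> \<kappa> * quad \<Gamma> (e i t)"
          using f_bound[of t "x i t" "z t"] \<kappa>(2)[of "e i t"] t assms(3) by (simp add: e_def)
        ultimately show ?thesis by simp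
      qed
      have "W' t \<le> (\<Sum>i=l+1..N. \<kappa> * quad \<Gamma> (e i t)
          + c t * (\<Sum>j=1..N. a i j * (e i t \<bullet> (\<Gamma> *v e j t))))"
        unfolding W'_def by (intro sum_mono node_bound)
      also have "\<dots> = \<kappa> * G t
          + c t * (\<Sum>i=l+1..N. \<Sum>j=1..N. a i j * (e i t \<bullet> (\<Gamma> *v e j t)))"
        by (simp only: sum.distrib sum_distrib_left G_def)
      also have "\<dots> \<le> \<kappa> * G t + c t * (- \<mu> * G t + M * (\<Sum>j=1..l. (norm (e j t))\<^sup>2))"
        unfolding G_def using c_nonneg t by (intro add_left_mono mult_left_mono coupling) auto
      also have "\<dots> \<le> \<kappa> * G t
          + c t * (- \<mu> * G t + M * ((\<Sum>j=1..l. \<alpha> j) * exp (- b * (t - t0))))"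
        using c_nonneg t M by (intro add_left_mono mult_left_mono leaders) auto
      finally show ?thesis by (simp add: algebra_simps)
    qed
    show "(c has_real_derivative \<zeta> * G t) (at t within {t0..})" if "t0 \<le> t" for t
      by (rule gain) fact
    show "0 \<le> c t0" by (rule c_nonneg) simp
    show "2 * \<gamma> * W t \<le> G t" for t
    proof -
      have "\<gamma> * (\<Sum>i=l+1..N. (norm (e i t))\<^sup>2) \<le> G t"
        unfolding G_def sum_distrib_left by (intro sum_mono \<gamma>)
      then show ?thesis by (simp add: W_def)
    qed
    show "0 \<le> M * (\<Sum>j=1..l. \<alpha> j)" using M \<alpha>_nonneg by (intro mult_nonneg_nonneg sum_nonneg) auto
    show "0 < 2 * \<gamma>" using \<gamma>(1) by simp
  qed (use \<mu> b(1) assms(16) \<kappa>(1) in auto)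

  show ?thesis
  proof
    fix i assume i: "i \<in> {1..N}"
    show "((\<lambda>t. norm (x i t - z t)) \<longlongrightarrow> 0) at_top"
    proof (cases "i \<le> l")
      case True
      then have i: "i \<in> {1..l}" using i by simp
      have "(\<theta> i \<longlongrightarrow> 0) at_top"
        unfolding \<theta>_def[abs_def] using \<beta>[OF i] by real_asymp
      moreover have "\<forall>\<^sub>F t in at_top. (norm (x i t - z t))\<^sup>2 \<le> \<theta> i t"
        using eventually_ge_at_top[of t0]
        by eventually_elim (use leader_bound[OF i] in \<open>simp add: V_def e_def\<close>)
      ultimately show ?thesis by (rule tendsto_norm_zero_if_square_bound)
    next
      case False
      have "((\<lambda>t. 2 * W t) \<longlongrightarrow> 2 * 0) at_top" by (intro tendsto_intros) fact
      moreover have "(norm (x i t - z t))\<^sup>2 \<le> 2 * W t" for t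
        using False i member_le_sum[of i "{l+1..N}" "\<lambda>i. (norm (e i t))\<^sup>2"]
        by (simp add: W_def e_def)
      ultimately show ?thesis by (intro tendsto_norm_zero_if_square_bound) auto
    qed
  qed
qed

end
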